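(* Let $X$ be a compact metrizable space with $|X|>2$. Then $\mathrm{R}(X)$ is a dense $G_\delta$ subset of $\operatorname{Met}(X)$.
   Context: For a metrizable space $X$, $\operatorname{Met}(X)$ denotes the set of all metrics on $X$ inducing the topology of $X$. For $d,e\in\operatorname{Met}(X)$, put $\mathcal D_X(d,e)=\sup_{x,y\in X}|d(x,y)-e(x,y)|\in[0,\infty]$. $\operatorname{Met}(X)$ carries the uniform topology, i.e. the topology induced by the metric $\min\{1,\mathcal D_X\}$. $\operatorname{Isom}(X,d)$ is the group of bijective self-isometries of $(X,d)$. The set of rigid metrics is $\mathrm{R}(X)=\{d\in\operatorname{Met}(X)\mid \operatorname{Isom}(X,d)=\{\mathrm{id}_X\}\}$. *)

theory Defs
  imports "HOL-Analysis.Analysis"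
begin

(* The locale predicate Metric_space M d leaves the values of d off M unconstrained except for
   symmetry and non-negativity; the last conjunct normalises them, so that elements of Met X
   correspond one-to-one to functions on topspace X \<times> topspace X. *)
definition Met :: "'a topology \<Rightarrow> ('a \<Rightarrow> 'a \<Rightarrow> real) set"
  where "Met X = {d. Metric_space (topspace X) d \<and>
                     Metric_space.mtopology (topspace X) d = X \<and>
                     (\<forall>x y. x \<notin> topspace X \<or> y \<notin> topspace X \<longrightarrow> d x y = 0)}"

definition sup_dist :: "'a topology \<Rightarrow> ('a \<Rightarrow> 'a \<Rightarrow> real) \<Rightarrow> ('a \<Rightarrow> 'a \<Rightarrow> real) \<Rightarrow> ennreal"
  where "sup_dist X d e = (SUP (x, y) \<in> topspace X \<times> topspace X. ennreal \<bar>d x y - e x y\<bar>)"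

definition bdd_sup_dist :: "'a topology \<Rightarrow> ('a \<Rightarrow> 'a \<Rightarrow> real) \<Rightarrow> ('a \<Rightarrow> 'a \<Rightarrow> real) \<Rightarrow> real"
  where "bdd_sup_dist X d e = enn2real (min 1 (sup_dist X d e))"

definition Met_topology :: "'a topology \<Rightarrow> ('a \<Rightarrow> 'a \<Rightarrow> real) topology"
  where "Met_topology X = Metric_space.mtopology (Met X) (bdd_sup_dist X)"

(* Self-maps of the carrier are represented by extensional functions, so that each
   isometry has exactly one representative. *)
definition Isom :: "'a set \<Rightarrow> ('a \<Rightarrow> 'a \<Rightarrow> real) \<Rightarrow> ('a \<Rightarrow> 'a) set"
  where "Isom M d = {f \<in> extensional M. bij_betw f M M \<and>
                       (\<forall>x\<in>M. \<forall>y\<in>M. d (f x) (f y) = d x y)}"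

definition rigid_metrics :: "'a topology \<Rightarrow> ('a \<Rightarrow> 'a \<Rightarrow> real) set"
  where "rigid_metrics X = {d \<in> Met X. Isom (topspace X) d = {\<lambda>x\<in>topspace X. x}}"

lemma sup_dist_upper:
  assumes "x \<in> topspace X" "y \<in> topspace X"
  shows "ennreal \<bar>d x y - e x y\<bar> \<le> sup_dist X d e"
  unfolding sup_dist_def by (rule SUP_upper2[of "(x, y)"]) (use assms in auto)

lemma sup_dist_triangle: "sup_dist X d f \<le> sup_dist X d e + sup_dist X e f"
proof -
  have "ennreal \<bar>d x y - f x y\<bar> \<le> sup_dist X d e + sup_dist X e f"
    if "x \<in> topspace X" "y \<in> topspace X" for x y
  proof -
    have "ennreal \<bar>d x y - f x y\<bar> \<le> ennreal (\<bar>d x y - e x y\<bar> + \<bar>e x y - f x y\<bar>)"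
      by (intro ennreal_leI) auto
    also have "\<dots> = ennreal \<bar>d x y - e x y\<bar> + ennreal \<bar>e x y - f x y\<bar>"
      by (simp add: ennreal_plus)
    also have "\<dots> \<le> sup_dist X d e + sup_dist X e f"
      by (intro add_mono sup_dist_upper that)
    finally show ?thesis .
  qed
  then show ?thesis
    unfolding sup_dist_def[of X d f] by (intro SUP_least) auto
qed

lemma Metric_space_Met: "Metric_space (Met X) (bdd_sup_dist X)"
proof
  fix d e :: "'a \<Rightarrow> 'a \<Rightarrow> real"
  show "0 \<le> bdd_sup_dist X d e"
    by (simp add: bdd_sup_dist_def)
  show "bdd_sup_dist X d e = bdd_sup_dist X e d"
    by (simp add: bdd_sup_dist_def sup_dist_def abs_minus_commute)
next
  fix d e assume de: "d \<in> Met X" "e \<in> Met X"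
  show "bdd_sup_dist X d e = 0 \<longleftrightarrow> d = e"
  proof
    assume "bdd_sup_dist X d e = 0"
    then have "min 1 (sup_dist X d e) = 0"
      by (auto simp: bdd_sup_dist_def enn2real_eq_0_iff min_def split: if_splits)
    then have 0: "sup_dist X d e = 0"
      by (auto simp: min_def split: if_splits)
    have "d x y = e x y" for x y
    proof (cases "x \<in> topspace X \<and> y \<in> topspace X")
      case True
      then show ?thesis
        using sup_dist_upper[of x X y d e] 0 by (simp add: ennreal_eq_0_iff)
    next
      case False
      then have "d x y = 0" "e x y = 0"
        using de by (auto simp: Met_def)
      then show ?thesis by simp
    qed
    then show "d = e" by blast
  next
    assume "d = e"
    then show "bdd_sup_dist X d e = 0"
      by (auto simp: bdd_sup_dist_def sup_dist_def SUP_constant bot_ennreal case_prod_unfold)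
  qed
next
  fix d e f :: "'a \<Rightarrow> 'a \<Rightarrow> real"
  let ?a = "sup_dist X d e" and ?b = "sup_dist X e f" and ?c = "sup_dist X d f"
  have "min 1 ?c \<le> min 1 (?a + ?b)"
    by (rule min.mono[OF order_refl sup_dist_triangle])
  also have "\<dots> \<le> min 1 ?a + min 1 ?b"
    by (auto simp: min_def add_increasing2 add_increasing)
  finally have le: "min 1 ?c \<le> min 1 ?a + min 1 ?b" .
  have fin: "min 1 u < top" for u :: ennreal
    by (simp add: min_less_iff_disj)
  have "enn2real (min 1 ?c) \<le> enn2real (min 1 ?a + min 1 ?b)"
    by (rule enn2real_mono[OF le]) (simp add: fin)
  also have "\<dots> = enn2real (min 1 ?a) + enn2real (min 1 ?b)"
    by (rule enn2real_plus) (simp_all add: fin)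
  finally show "bdd_sup_dist X d f \<le> bdd_sup_dist X d e + bdd_sup_dist X e f"
    by (simp add: bdd_sup_dist_def)
qed

lemma topspace_Met_topology [simp]: "topspace (Met_topology X) = Met X"
  unfolding Met_topology_def by (rule Metric_space.topspace_mtopology[OF Metric_space_Met])

end

(* Moving a fixed point x by less than 1/n under every isometry is an open condition on the
   metric, by compactness of the space of pairs of self-maps of X; intersecting over a countable
   dense set of points x and over n shows that the rigid metrics form a G_delta set.

   For density, each of countably many open conditions is realised by a small perturbation that
   only increases the metric, and Baire's theorem is applied. A non-isolated point p is pinned
   down by first snowflaking the metric at small scales, which removes all short arithmetic
   progressions, and then planting one at p. For isolated points a, the distances from a are made
   different from all distances avoiding a; a third point then prevents two isolated points from
   being exchanged. *)

theory Submission
  imports Defs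
begin

section \<open>Compatible metrics and a criterion for membership in \<open>Met X\<close>\<close>

lemma Metric_space_of_Met: "d \<in> Met X \<Longrightarrow> Metric_space (topspace X) d"
  by (simp add: Met_def)

lemma openin_Met_iff:
  assumes "d \<in> Met X"
  shows "openin X U \<longleftrightarrow> U \<subseteq> topspace X \<and> (\<forall>x\<in>U. \<exists>r>0. \<forall>y\<in>topspace X. d x y < r \<longrightarrow> y \<in> U)"
proof -
  interpret Metric_space "topspace X" d
    using assms by (rule Metric_space_of_Met)
  have "openin X U \<longleftrightarrow> openin mtopology U"
    using assms by (simp add: Met_def)
  also have "\<dots> \<longleftrightarrow> U \<subseteq> topspace X \<and> (\<forall>x\<in>U. \<exists>r>0. \<forall>y\<in>topspace X. d x y < r \<longrightarrow> y \<in> U)"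
    unfolding openin_mtopology mball_def by blast
  finally show ?thesis .
qed

text \<open>Both metrics induce the same topology, so the \<open>e\<close>-ball around
  \<open>x\<close> is open in \<open>X\<close> and contains a \<open>d\<close>-ball around
  \<open>x\<close>.\<close>

lemma Met_continuous_diagonal:
  assumes d: "d \<in> Met X" and e: "e \<in> Met X" and x: "x \<in> topspace X" and "0 < \<epsilon>"
  shows "\<exists>\<delta>>0. \<forall>y\<in>topspace X. d x y < \<delta> \<longrightarrow> e x y < \<epsilon>"
proof -
  interpret Metric_space "topspace X" e
    using e by (rule Metric_space_of_Met)
  have "openin X (mball x \<epsilon>)"
    using openin_mball[of x \<epsilon>] e unfolding Met_def by force
  moreover have "x \<in> mball x \<epsilon>"
    using x \<open>0 < \<epsilon>\<close> by simp
  ultimately obtain \<delta> where "\<delta> > 0" "\<forall>y\<in>topspace X. d x y < \<delta> \<longrightarrow> y \<in> mball x \<epsilon>"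
    unfolding openin_Met_iff[OF d] by blast
  then show ?thesis
    by auto
qed

text \<open>The bound \<open>d \<le> g\<close> gives nonnegativity and definiteness, and makes every
  open set of \<open>X\<close> open for \<open>e\<close>; smallness of \<open>g\<close> near the
  diagonal gives the converse inclusion of topologies. Perturbations and uniform limits are shown to
  lie in \<open>Met X\<close> this way.\<close>

lemma Met_dominatingI:
  fixes X :: "'a topology" and g :: "'a \<Rightarrow> 'a \<Rightarrow> real"
  defines "e \<equiv> \<lambda>x y. if x \<in> topspace X \<and> y \<in> topspace X then g x y else 0"
  assumes d: "d \<in> Met X"
    and le: "\<And>x y. \<lbrakk>x \<in> topspace X; y \<in> topspace X\<rbrakk> \<Longrightarrow> d x y \<le> g x y"
    and refl: "\<And>x. x \<in> topspace X \<Longrightarrow> g x x = 0"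
    and sym: "\<And>x y. \<lbrakk>x \<in> topspace X; y \<in> topspace X\<rbrakk> \<Longrightarrow> g x y = g y x"
    and tri: "\<And>x y z. \<lbrakk>x \<in> topspace X; y \<in> topspace X; z \<in> topspace X\<rbrakk> \<Longrightarrow> g x z \<le> g x y + g y z"
    and cont: "\<And>x \<epsilon>. \<lbrakk>x \<in> topspace X; 0 < \<epsilon>\<rbrakk> \<Longrightarrow> \<exists>\<delta>>0. \<forall>y\<in>topspace X. d x y < \<delta> \<longrightarrow> g x y < \<epsilon>"
  shows "e \<in> Met X"
proof -
  interpret d: Metric_space "topspace X" d
    using d by (rule Metric_space_of_Met)
  have ms: "Metric_space (topspace X) e"
  proof
    fix x y
    show "0 \<le> e x y"
      using order_trans[OF d.nonneg le] by (simp add: e_def)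
    show "e x y = e y x"
      using sym by (auto simp: e_def)
  next
    fix x y assume xy: "x \<in> topspace X" "y \<in> topspace X"
    show "e x y = 0 \<longleftrightarrow> x = y"
    proof
      assume "e x y = 0"
      then have "d x y \<le> 0"
        using le[OF xy] xy by (simp add: e_def)
      then show "x = y"
        using d.zero[OF xy] d.nonneg[of x y] by (metis order_antisym)
    qed (use refl xy in \<open>simp add: e_def\<close>)
  next
    fix x y z assume "x \<in> topspace X" "y \<in> topspace X" "z \<in> topspace X"
    then show "e x z \<le> e x y + e y z"
      using tri by (simp add: e_def)
  qed
  interpret e: Metric_space "topspace X" e by (rule ms)
  have "openin e.mtopology U \<longleftrightarrow> openin X U" for U
  proof
    assume U: "openin e.mtopology U"
    show "openin X U"
      unfolding openin_Met_iff[OF d]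
    proof (intro conjI ballI)
      show sub: "U \<subseteq> topspace X"
        using U by (simp add: e.openin_mtopology)
      fix x assume x: "x \<in> U"
      then obtain r where r: "r > 0" "e.mball x r \<subseteq> U"
        using U by (auto simp: e.openin_mtopology)
      have xM: "x \<in> topspace X"
        using x sub by blast
      obtain \<delta> where \<delta>: "\<delta> > 0" "\<forall>y\<in>topspace X. d x y < \<delta> \<longrightarrow> g x y < r"
        using cont[OF xM r(1)] by blast
      have "y \<in> U" if y: "y \<in> topspace X" "d x y < \<delta>" for y
      proof -
        have "e x y < r"
          using \<delta>(2) y xM by (simp add: e_def)
        then show ?thesis
          using r(2) y(1) xM by (auto)
      qed
      then show "\<exists>r>0. \<forall>y\<in>topspace X. d x y < r \<longrightarrow> y \<in> U"
        using \<delta>(1) by blast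
    qed
  next
    assume U: "openin X U"
    then have sub: "U \<subseteq> topspace X"
      by (rule openin_subset)
    show "openin e.mtopology U"
      unfolding e.openin_mtopology
    proof (intro conjI allI impI)
      fix x assume x: "x \<in> U"
      then obtain r where r: "r > 0" "\<forall>y\<in>topspace X. d x y < r \<longrightarrow> y \<in> U"
        using U unfolding openin_Met_iff[OF d] by blast
      have "y \<in> U" if "y \<in> e.mball x r" for y
      proof -
        have y: "x \<in> topspace X" "y \<in> topspace X" "e x y < r"
          using that by simp_all
        then have "d x y < r"
          using le[OF y(1,2)] by (simp add: e_def)
        then show ?thesis
          using r(2) y(2) by blast
      qed
      then show "\<exists>r>0. e.mball x r \<subseteq> U"
        using r(1) by blast
    qed (rule sub)
  qed
  then have "e.mtopology = X"
    by (simp add: topology_eq)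
  then show ?thesis
    using ms by (auto simp: Met_def e_def)
qed

section \<open>Truncated uniform distance and uniform neighbourhoods\<close>

lemma less_bdd_sup_dist:
  assumes "bdd_sup_dist X d e < \<epsilon>" "\<epsilon> \<le> 1" "x \<in> topspace X" "y \<in> topspace X"
  shows "\<bar>d x y - e x y\<bar> < \<epsilon>"
proof -
  have "0 < \<epsilon>"
    using assms(1) enn2real_nonneg[of "min 1 (sup_dist X d e)"] unfolding bdd_sup_dist_def by linarith
  have "min 1 (sup_dist X d e) = ennreal (bdd_sup_dist X d e)"
    unfolding bdd_sup_dist_def by (simp add: min_less_iff_disj)
  also have "\<dots> < ennreal \<epsilon>"
    using assms(1) \<open>0 < \<epsilon>\<close> by (simp add: ennreal_lessI)
  finally have "min 1 (sup_dist X d e) < ennreal \<epsilon>" .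
  \<comment> \<open>Because of this bound, the entry 1 cannot be what makes the minimum
    small.\<close>
  moreover have "ennreal \<epsilon> \<le> 1"
    using \<open>\<epsilon> \<le> 1\<close> by simp
  ultimately have "sup_dist X d e < ennreal \<epsilon>"
    by (auto simp: min_less_iff_disj)
  then have "ennreal \<bar>d x y - e x y\<bar> < ennreal \<epsilon>"
    using sup_dist_upper[OF assms(3,4)] by (rule le_less_trans[rotated])
  then show ?thesis
    using \<open>0 < \<epsilon>\<close> by (simp add: ennreal_less_iff)
qed

lemma bdd_sup_dist_le:
  assumes "\<And>x y. \<lbrakk>x \<in> topspace X; y \<in> topspace X\<rbrakk> \<Longrightarrow> \<bar>d x y - e x y\<bar> \<le> c" and "0 \<le> c"
  shows "bdd_sup_dist X d e \<le> c"
proof -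
  have "sup_dist X d e \<le> ennreal c"
    unfolding sup_dist_def using assms by (auto intro!: SUP_least ennreal_leI)
  then have "min 1 (sup_dist X d e) \<le> ennreal c"
    by (rule min.coboundedI2)
  then show ?thesis
    unfolding bdd_sup_dist_def using \<open>0 \<le> c\<close> by (rule enn2real_leI[rotated])
qed

text \<open>Replaces balls of the truncated distance by uniform \<delta>-neighbourhoods;
  \<open>min \<delta> 1\<close> serves as radius because the truncated distance bounds differences
  only for radii up to 1.\<close>

lemma openin_Met_topologyI:
  assumes "U \<subseteq> Met X"
    and "\<And>e. e \<in> U \<Longrightarrow> \<exists>\<delta>>0. \<forall>e'\<in>Met X.
           (\<forall>x\<in>topspace X. \<forall>y\<in>topspace X. \<bar>e x y - e' x y\<bar> < \<delta>) \<longrightarrow> e' \<in> U"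
  shows "openin (Met_topology X) U"
proof -
  interpret Metric_space "Met X" "bdd_sup_dist X"
    by (rule Metric_space_Met)
  show ?thesis
    unfolding Met_topology_def openin_mtopology
  proof (intro conjI allI impI)
    fix e assume "e \<in> U"
    then obtain \<delta> where \<delta>: "\<delta> > 0" "\<And>e'. \<lbrakk>e' \<in> Met X; \<forall>x\<in>topspace X. \<forall>y\<in>topspace X. \<bar>e x y - e' x y\<bar> < \<delta>\<rbrakk> \<Longrightarrow> e' \<in> U"
      using assms(2) by metis
    have "mball e (min \<delta> 1) \<subseteq> U"
      using \<delta>(2) less_bdd_sup_dist[of X e _ "min \<delta> 1"] by (fastforce simp: subset_iff)
    then show "\<exists>r>0. mball e r \<subseteq> U"
      using \<delta>(1) by (intro exI[of _ "min \<delta> 1"]) auto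
  qed (use assms(1) in auto)
qed

section \<open>Completeness and Baire category for metrics dominating a fixed one\<close>

definition dominating :: "'a topology \<Rightarrow> ('a \<Rightarrow> 'a \<Rightarrow> real) \<Rightarrow> ('a \<Rightarrow> 'a \<Rightarrow> real) set"
  where "dominating X d = {e \<in> Met X. \<forall>x\<in>topspace X. \<forall>y\<in>topspace X. d x y \<le> e x y}"

lemma Metric_space_dominating: "Metric_space (dominating X d) (bdd_sup_dist X)"
  by (rule Metric_space.subspace[OF Metric_space_Met]) (auto simp: dominating_def)

text \<open>A Cauchy sequence converges uniformly to a function \<open>g\<close>;
  \<open>d \<le> g\<close> survives the limit, so distinct points keep positive distance, and
  uniform convergence transfers smallness near the diagonal from one \<open>s N\<close> to
  \<open>g\<close>.\<close>

lemma mcomplete_dominating: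
  assumes d: "d \<in> Met X"
  shows "Metric_space.mcomplete (dominating X d) (bdd_sup_dist X)"
proof -
  interpret E: Metric_space "dominating X d" "bdd_sup_dist X"
    by (rule Metric_space_dominating)
  show ?thesis
    unfolding E.mcomplete_def
  proof (intro allI impI)
    fix s assume s: "E.MCauchy s"
    have sE: "s n \<in> dominating X d" for n
      using s by (auto simp: E.MCauchy_def)
    then have sM: "s n \<in> Met X" for n
      by (simp add: dominating_def)
    have cauchy: "\<exists>N. \<forall>m\<ge>N. \<forall>n\<ge>N. \<forall>x\<in>topspace X. \<forall>y\<in>topspace X. \<bar>s m x y - s n x y\<bar> < \<epsilon>"
      if "\<epsilon> > 0" for \<epsilon>
    proof -
      have "min \<epsilon> 1 > 0"
        using that by simp
      then obtain N where N: "\<forall>m n. N \<le> m \<longrightarrow> N \<le> n \<longrightarrow> bdd_sup_dist X (s m) (s n) < min \<epsilon> 1"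
        using s unfolding E.MCauchy_def by blast
      have "\<bar>s m x y - s n x y\<bar> < \<epsilon>"
        if "m \<ge> N" "n \<ge> N" "x \<in> topspace X" "y \<in> topspace X" for m n x y
        using less_bdd_sup_dist[of X "s m" "s n" "min \<epsilon> 1" x y] N that by simp
      then show ?thesis by blast
    qed
    define g where "g x y = lim (\<lambda>n. s n x y)" for x y
    have conv: "(\<lambda>n. s n x y) \<longlonglongrightarrow> g x y" if "x \<in> topspace X" "y \<in> topspace X" for x y
    proof -
      have "Cauchy (\<lambda>n. s n x y)"
        using cauchy that unfolding Cauchy_def dist_real_def by meson
      then show ?thesis
        unfolding g_def by (simp add: Cauchy_convergent convergent_LIMSEQ_iff[symmetric])
    qed
    have unif: "\<exists>N. \<forall>n\<ge>N. \<forall>x\<in>topspace X. \<forall>y\<in>topspace X. \<bar>s n x y - g x y\<bar> \<le> \<epsilon>"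
      if \<epsilon>: "\<epsilon> > 0" for \<epsilon>
    proof -
      obtain N where N: "\<And>m n x y. \<lbrakk>m \<ge> N; n \<ge> N; x \<in> topspace X; y \<in> topspace X\<rbrakk> \<Longrightarrow> \<bar>s m x y - s n x y\<bar> < \<epsilon>"
        using cauchy[OF \<epsilon>] by blast
      have "\<bar>s n x y - g x y\<bar> \<le> \<epsilon>" if "n \<ge> N" "x \<in> topspace X" "y \<in> topspace X" for n x y
      proof (rule LIMSEQ_le_const2)
        show "(\<lambda>m. \<bar>s n x y - s m x y\<bar>) \<longlonglongrightarrow> \<bar>s n x y - g x y\<bar>"
          by (intro tendsto_intros conv that)
        show "\<exists>M. \<forall>m\<ge>M. \<bar>s n x y - s m x y\<bar> \<le> \<epsilon>"
          using N that by (intro exI[of _ N]) (auto intro: less_imp_le)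
      qed
      then show ?thesis by blast
    qed
    define e where "e x y = (if x \<in> topspace X \<and> y \<in> topspace X then g x y else 0)" for x y
    have le: "d x y \<le> g x y" if "x \<in> topspace X" "y \<in> topspace X" for x y
      using sE that by (intro LIMSEQ_le_const[OF conv[OF that]]) (auto simp: dominating_def)
    have "e \<in> Met X"
      unfolding e_def
    proof (rule Met_dominatingI[OF d le])
      fix x y z assume xyz: "x \<in> topspace X" "y \<in> topspace X" "z \<in> topspace X"
      show "g x z \<le> g x y + g y z"
        using Metric_space.triangle[OF Metric_space_of_Met[OF sM] xyz]
        by (intro LIMSEQ_le[OF conv tendsto_add[OF conv conv]] xyz) auto
    next
      fix x \<epsilon> assume x: "x \<in> topspace X" and \<epsilon>: "(0::real) < \<epsilon>"
      obtain N where N: "\<forall>n\<ge>N. \<forall>x\<in>topspace X. \<forall>y\<in>topspace X. \<bar>s n x y - g x y\<bar> \<le> \<epsilon>/2"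
        using unif[of "\<epsilon>/2"] \<epsilon> by auto
      obtain \<delta> where \<delta>: "\<delta> > 0" "\<forall>y\<in>topspace X. d x y < \<delta> \<longrightarrow> s N x y < \<epsilon>/2"
        using Met_continuous_diagonal[OF d sM x, of "\<epsilon>/2" N] \<epsilon> by auto
      have "g x y < \<epsilon>" if "y \<in> topspace X" "d x y < \<delta>" for y
      proof -
        have "\<bar>s N x y - g x y\<bar> \<le> \<epsilon>/2" "s N x y < \<epsilon>/2"
          using N \<delta>(2) x that by auto
        then show ?thesis by linarith
      qed
      then show "\<exists>\<delta>>0. \<forall>y\<in>topspace X. d x y < \<delta> \<longrightarrow> g x y < \<epsilon>"
        using \<delta>(1) by blast
    next
      fix x assume x: "x \<in> topspace X"
      have "s n x x = 0" for n
        using Metric_space.zero[OF Metric_space_of_Met[OF sM] x x] by simp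
      then show "g x x = 0"
        by (simp add: g_def)
    next
      fix x y
      have "s n x y = s n y x" for n
        using Metric_space.commute[OF Metric_space_of_Met[OF sM]] .
      then show "g x y = g y x"
        by (simp add: g_def)
    qed
    then have eE: "e \<in> dominating X d"
      using le by (simp add: dominating_def e_def)
    have "limitin E.mtopology s e sequentially"
      unfolding E.limitin_metric
    proof (intro conjI allI impI eE)
      fix \<epsilon> :: real assume \<epsilon>: "0 < \<epsilon>"
      obtain N where N: "\<forall>n\<ge>N. \<forall>x\<in>topspace X. \<forall>y\<in>topspace X. \<bar>s n x y - g x y\<bar> \<le> \<epsilon>/2"
        using unif[of "\<epsilon>/2"] \<epsilon> by auto
      have "bdd_sup_dist X (s n) e \<le> \<epsilon>/2" if "n \<ge> N" for n
        using N that \<epsilon> by (intro bdd_sup_dist_le) (auto simp: e_def)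
      then have "\<forall>n\<ge>N. s n \<in> dominating X d \<and> bdd_sup_dist X (s n) e < \<epsilon>"
        using sE \<epsilon> by fastforce
      then show "\<forall>\<^sub>F n in sequentially. s n \<in> dominating X d \<and> bdd_sup_dist X (s n) e < \<epsilon>"
        unfolding eventually_sequentially by blast
    qed
    then show "\<exists>e. limitin E.mtopology s e sequentially"
      by (intro exI)
  qed
qed

text \<open>Instead of complete metrizability of \<open>Met X\<close>, Baire category is used in the space of metrics
  dominating \<open>d\<close>, which is complete because uniform limits cannot degenerate to pseudometrics.
  The price is that approximations have to be made from above.\<close>

lemma dense_Inter_Met:
  assumes "countable \<U>"
    and op: "\<And>U. U \<in> \<U> \<Longrightarrow> openin (Met_topology X) U"
    and approx: "\<And>U e \<epsilon>. \<lbrakk>U \<in> \<U>; e \<in> Met X; 0 < \<epsilon>\<rbrakk> \<Longrightarrow> \<exists>e'\<in>U.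
      \<forall>x\<in>topspace X. \<forall>y\<in>topspace X. e x y \<le> e' x y \<and> e' x y \<le> e x y + \<epsilon>"
    and d: "d \<in> Met X" and "0 < \<epsilon>"
  shows "\<exists>e\<in>Met X \<inter> \<Inter>\<U>. bdd_sup_dist X d e < \<epsilon>"
proof -
  interpret M: Metric_space "Met X" "bdd_sup_dist X"
    by (rule Metric_space_Met)
  interpret E: Metric_space "dominating X d" "bdd_sup_dist X"
    by (rule Metric_space_dominating)
  have ball: "E.mball e r = dominating X d \<inter> M.mball e r" if "e \<in> dominating X d" for e r
    using that unfolding E.mball_def M.mball_def by (auto simp: dominating_def)
  \<comment> \<open>The carrier is included so that the intersection stays inside it even for an
    empty family.\<close>
  let ?G = "insert (dominating X d) ((\<lambda>U. U \<inter> dominating X d) ` \<U>)"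
  have "E.mtopology closure_of \<Inter>?G = dominating X d"
  proof (rule E.metric_Baire_category[OF mcomplete_dominating[OF d]])
    show "countable ?G"
      using \<open>countable \<U>\<close> by simp
    fix T assume "T \<in> ?G"
    then consider "T = dominating X d" | U where "U \<in> \<U>" "T = U \<inter> dominating X d"
      by auto
    then show "openin E.mtopology T \<and> E.mtopology closure_of T = dominating X d"
    proof cases
      case 1
      then show ?thesis
        by (metis E.topspace_mtopology closure_of_topspace openin_topspace)
    next
      case 2
      have "openin E.mtopology T"
        unfolding E.openin_mtopology
      proof (intro conjI allI impI)
        fix e assume e: "e \<in> T"
        then obtain r where "r > 0" "M.mball e r \<subseteq> U"
          using op[OF 2(1)] 2(2) unfolding Met_topology_def M.openin_mtopology by blast
        then show "\<exists>r>0. E.mball e r \<subseteq> T"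
          using ball e 2(2) by blast
      qed (use 2(2) in auto)
      moreover have "\<exists>e'\<in>T. e' \<in> E.mball e r" if e: "e \<in> dominating X d" and r: "r > 0" for e r
      proof -
        obtain e' where e': "e' \<in> U"
            "\<forall>x\<in>topspace X. \<forall>y\<in>topspace X. e x y \<le> e' x y \<and> e' x y \<le> e x y + r/2"
          using approx[OF 2(1), of e "r/2"] e r by (auto simp: dominating_def)
        have "e' \<in> Met X"
          using openin_subset[OF op[OF 2(1)]] e'(1) by auto
        then have e'D: "e' \<in> dominating X d"
          using e e'(2) unfolding dominating_def by (blast intro: order_trans)
        have "bdd_sup_dist X e e' \<le> r/2"
          using e'(2) r by (intro bdd_sup_dist_le) (force simp: abs_le_iff algebra_simps)+
        then show ?thesis
          using e'(1) e'D e r 2(2) by (intro bexI[of _ e']) auto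
      qed
      ultimately show ?thesis
        unfolding E.metric_closure_of by blast
    qed
  qed
  moreover have "d \<in> dominating X d"
    using d by (simp add: dominating_def)
  ultimately obtain e where e: "e \<in> \<Inter>?G" "e \<in> E.mball d \<epsilon>"
    using \<open>0 < \<epsilon>\<close> unfolding E.metric_closure_of by blast
  then have "e \<in> dominating X d" "\<forall>U\<in>\<U>. e \<in> U"
    by blast+
  moreover have "bdd_sup_dist X d e < \<epsilon>"
    using e(2) by simp
  ultimately show ?thesis
    unfolding dominating_def by blast
qed

section \<open>Approximate isometries and openness of the displacement condition\<close>

lemma continuous_map_Met:
  assumes e: "e \<in> Met X" and a: "a \<in> topspace X"
  shows "continuous_map X euclideanreal (e a)"
proof -
  interpret Metric_space "topspace X" e
    using e by (rule Metric_space_of_Met)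
  have "continuous_map mtopology euclidean (e a)"
    using continuous_on_mdist[of a "metric (topspace X, e)"] a by simp
  then show ?thesis
    using e by (simp add: Met_def)
qed

text \<open>Putting \<open>v = f u\<close> makes the left side 0, hence \<open>g (f u) = u\<close>;
  symmetrically \<open>f (g v) = v\<close>. So \<open>f\<close> is a bijection, and inserting
  \<open>f v\<close> for \<open>v\<close> yields the isometry identity.\<close>

lemma IsomI_adjoint:
  assumes e: "e \<in> Met X"
    and f: "f \<in> topspace X \<rightarrow> topspace X" and g: "g \<in> topspace X \<rightarrow> topspace X"
    and adj: "\<And>u v. \<lbrakk>u \<in> topspace X; v \<in> topspace X\<rbrakk> \<Longrightarrow> e (f u) v = e u (g v)"
  shows "restrict f (topspace X) \<in> Isom (topspace X) e"
proof -
  interpret Metric_space "topspace X" e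
    using e by (rule Metric_space_of_Met)
  have gf: "g (f u) = u" if "u \<in> topspace X" for u
    using adj[of u "f u"] that f g by (auto simp: Pi_iff)
  have fg: "f (g v) = v" if "v \<in> topspace X" for v
    using adj[of "g v" v] that f g by (auto simp: Pi_iff)
  have "bij_betw f (topspace X) (topspace X)"
    by (rule bij_betw_byWitness[of _ g]) (use gf fg f g in auto)
  moreover have "e (f u) (f v) = e u v" if "u \<in> topspace X" "v \<in> topspace X" for u v
    using adj[of u "f v"] that f gf by (auto simp: Pi_iff)
  ultimately show ?thesis
    unfolding Isom_def by (simp cong: bij_betw_cong)
qed

text \<open>A pair with \<open>e (f u) v\<close> close to \<open>e u (g v)\<close> is an approximate isometry together with its
  approximate inverse; in the limit both become exact, so no surjectivity argument is needed.\<close>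

lemma approximate_isometry_displacement:
  assumes X: "compact_space X" and e: "e \<in> Met X" and \<rho>: "\<rho> \<in> Met X" and x: "x \<in> topspace X"
    and isom: "\<forall>f\<in>Isom (topspace X) e. \<rho> x (f x) < r"
  shows "\<exists>\<delta>>0. \<forall>f \<in> topspace X \<rightarrow> topspace X. \<forall>g \<in> topspace X \<rightarrow> topspace X.
    (\<forall>u\<in>topspace X. \<forall>v\<in>topspace X. \<bar>e (f u) v - e u (g v)\<bar> \<le> \<delta>) \<longrightarrow> \<rho> x (f x) < r"
proof (rule ccontr)
  assume "\<not> ?thesis"
  then have neg: "\<exists>f g. f \<in> topspace X \<rightarrow> topspace X \<and> g \<in> topspace X \<rightarrow> topspace X \<and>
      (\<forall>u\<in>topspace X. \<forall>v\<in>topspace X. \<bar>e (f u) v - e u (g v)\<bar> \<le> \<delta>) \<and> r \<le> \<rho> x (f x)"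
    if "\<delta> > 0" for \<delta>
    using that by (meson not_le)
  \<comment> \<open>A pair \<open>(f, g)\<close> becomes one point of a product of copies of
    \<open>X\<close>, compact by Tychonoff: coordinate \<open>(u, True)\<close> holds
    \<open>f u\<close>, coordinate \<open>(v, False)\<close> holds \<open>g v\<close>.\<close>
  let ?I = "topspace X \<times> (UNIV :: bool set)"
  let ?P = "product_topology (\<lambda>_. X) ?I"
  interpret e: Metric_space "topspace X" e
    using e by (rule Metric_space_of_Met)
  \<comment> \<open>\<open>C n\<close> collects the pairs with error at most
    \<open>1 / (n + 1)\<close> that still move \<open>x\<close> by at least \<open>r\<close>. All
    distances are written with the variable point second, to fit \<open>continuous_map_Met\<close>;
    this makes \<open>C n\<close> closed in the product.\<close>
  define C where "C n = {h \<in> topspace ?P. r \<le> \<rho> x (h (x, True))} \<inter>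
      (\<Inter>u\<in>topspace X. \<Inter>v\<in>topspace X. {h \<in> topspace ?P.
         \<bar>e v (h (u, True)) - e u (h (v, False))\<bar> \<le> inverse (real (Suc n))})" for n
  have cont: "continuous_map ?P euclideanreal (\<lambda>h. c a (h (u, b)))"
    if "c \<in> Met X" "a \<in> topspace X" "u \<in> topspace X" for c a u b
    using continuous_map_compose[OF continuous_map_product_projection[of "(u, b)" ?I "\<lambda>_. X"]
        continuous_map_Met[OF that(1,2)]] that(3)
    by (simp add: o_def)
  have "(\<Inter>n. C n) \<noteq> {}"
  proof (rule compact_space_imp_nest)
    show "compact_space ?P"
      using X by (simp add: compact_space_product_topology)
    show "closedin ?P (C n)" for n
    proof -
      have "closedin ?P {h \<in> topspace ?P. \<rho> x (h (x, True)) \<in> {r..}}"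
        by (rule closedin_continuous_map_preimage[OF cont[OF \<rho> x x]]) simp
      moreover have "closedin ?P {h \<in> topspace ?P.
          \<bar>e v (h (u, True)) - e u (h (v, False))\<bar> \<in> {..inverse (real (Suc n))}}"
        if "u \<in> topspace X" "v \<in> topspace X" for u v
        by (rule closedin_continuous_map_preimage
              [OF continuous_map_real_abs[OF continuous_map_diff[OF cont cont]]])
          (use e that in simp_all)
      ultimately show ?thesis
        unfolding C_def using x by (intro closedin_Int closedin_INT) auto
    qed
    show "C n \<noteq> {}" for n
    proof -
      obtain f g where fg: "f \<in> topspace X \<rightarrow> topspace X" "g \<in> topspace X \<rightarrow> topspace X"
        "\<forall>u\<in>topspace X. \<forall>v\<in>topspace X. \<bar>e (f u) v - e u (g v)\<bar> \<le> inverse (real (Suc n))"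
        "r \<le> \<rho> x (f x)"
        using neg[of "inverse (real (Suc n))"] by auto
      let ?h = "\<lambda>i\<in>?I. if snd i then f (fst i) else g (fst i)"
      have "?h \<in> C n"
        using fg x by (auto simp: C_def e.commute PiE_iff)
      then show ?thesis by blast
    qed
    have "C n \<subseteq> C m" if "m \<le> n" for m n
    proof -
      have "inverse (real (Suc n)) \<le> inverse (real (Suc m))"
        using that by simp
      then show ?thesis
        unfolding C_def by (blast intro: order_trans)
    qed
    then show "decseq C"
      by (simp add: decseq_def)
  qed
  then obtain h where h: "\<And>n. h \<in> C n"
    by blast
  let ?f = "\<lambda>u. h (u, True)" and ?g = "\<lambda>v. h (v, False)"
  have "restrict ?f (topspace X) \<in> Isom (topspace X) e"
  proof (rule IsomI_adjoint[OF e])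
    show "?f \<in> topspace X \<rightarrow> topspace X" "?g \<in> topspace X \<rightarrow> topspace X"
      using h[of 0] by (auto simp: C_def PiE_iff)
    fix u v assume uv: "u \<in> topspace X" "v \<in> topspace X"
    have "\<bar>e v (?f u) - e u (?g v)\<bar> \<le> inverse (real (Suc n))" for n
      using h[of n] uv by (simp add: C_def)
    then have "\<bar>e v (?f u) - e u (?g v)\<bar> \<le> 0"
      using LIMSEQ_le_const[OF LIMSEQ_inverse_real_of_nat] by blast
    then show "e (?f u) v = e u (?g v)"
      by (simp add: e.commute)
  qed
  then have "\<rho> x (?f x) < r"
    using isom x by force
  moreover have "r \<le> \<rho> x (?f x)"
    using h[of 0] by (simp add: C_def)
  ultimately show False
    by simp
qed

text \<open>For \<open>e'\<close> within \<delta>/2 of \<open>e\<close>, an isometry of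
  \<open>e'\<close> and its inverse satisfy the approximate adjoint identity for \<open>e\<close>
  with error at most \<delta>, one half from each side.\<close>

lemma openin_displacement:
  assumes X: "compact_space X" and \<rho>: "\<rho> \<in> Met X" and x: "x \<in> topspace X"
  shows "openin (Met_topology X) {e \<in> Met X. \<forall>f\<in>Isom (topspace X) e. \<rho> x (f x) < r}"
proof (rule openin_Met_topologyI)
  fix e assume e: "e \<in> {e \<in> Met X. \<forall>f\<in>Isom (topspace X) e. \<rho> x (f x) < r}"
  then have "e \<in> Met X" "\<forall>f\<in>Isom (topspace X) e. \<rho> x (f x) < r"
    by auto
  from approximate_isometry_displacement[OF X this(1) \<rho> x this(2)]
  obtain \<delta> where \<delta>: "0 < \<delta>" and
    appr: "\<forall>f \<in> topspace X \<rightarrow> topspace X. \<forall>g \<in> topspace X \<rightarrow> topspace X.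
      (\<forall>u\<in>topspace X. \<forall>v\<in>topspace X. \<bar>e (f u) v - e u (g v)\<bar> \<le> \<delta>) \<longrightarrow> \<rho> x (f x) < r"
    by (elim exE conjE)
  have "\<rho> x (f x) < r"
    if e': "e' \<in> Met X" and close: "\<forall>x\<in>topspace X. \<forall>y\<in>topspace X. \<bar>e x y - e' x y\<bar> < \<delta> / 2"
      and f: "f \<in> Isom (topspace X) e'" for e' f
  proof -
    have bij: "bij_betw f (topspace X) (topspace X)"
      and iso: "\<And>x y. \<lbrakk>x \<in> topspace X; y \<in> topspace X\<rbrakk> \<Longrightarrow> e' (f x) (f y) = e' x y"
      using f by (auto simp: Isom_def)
    let ?g = "inv_into (topspace X) f"
    have fM: "f \<in> topspace X \<rightarrow> topspace X" and gM: "?g \<in> topspace X \<rightarrow> topspace X"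
      using bij_betw_imp_funcset[OF bij] bij_betw_imp_funcset[OF bij_betw_inv_into[OF bij]] by auto
    have "\<bar>e (f u) v - e u (?g v)\<bar> \<le> \<delta>" if uv: "u \<in> topspace X" "v \<in> topspace X" for u v
    proof -
      have mem: "f u \<in> topspace X" "?g v \<in> topspace X"
        using fM gM uv by auto
      have "e' (f u) v = e' u (?g v)"
        using iso[OF uv(1) mem(2)] bij_betw_inv_into_right[OF bij uv(2)] by simp
      moreover have "\<bar>e (f u) v - e' (f u) v\<bar> < \<delta> / 2" "\<bar>e u (?g v) - e' u (?g v)\<bar> < \<delta> / 2"
        using close mem uv by blast+
      ultimately show ?thesis
        by linarith
    qed
    then show ?thesis
      using appr fM gM by blast
  qed
  then show "\<exists>\<delta>>0. \<forall>e'\<in>Met X. (\<forall>x\<in>topspace X. \<forall>y\<in>topspace X. \<bar>e x y - e' x y\<bar> < \<delta>) \<longrightarrow>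
      e' \<in> {e \<in> Met X. \<forall>f\<in>Isom (topspace X) e. \<rho> x (f x) < r}"
    using \<delta> by (intro exI[of _ "\<delta> / 2"]) auto
qed auto

section \<open>Perturbations at isolated points and at limit points\<close>

lemma openin_Met_distances_neq:
  assumes "a \<in> topspace X" "b \<in> topspace X" "c \<in> topspace X" "d \<in> topspace X"
  shows "openin (Met_topology X) {e \<in> Met X. e a b \<noteq> e c d}"
proof (rule openin_Met_topologyI)
  fix e assume "e \<in> {e \<in> Met X. e a b \<noteq> e c d}"
  then have pos: "\<bar>e a b - e c d\<bar> / 2 > 0"
    by simp
  have "e' a b \<noteq> e' c d"
    if "\<forall>x\<in>topspace X. \<forall>y\<in>topspace X. \<bar>e x y - e' x y\<bar> < \<bar>e a b - e c d\<bar> / 2" for e'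
  proof -
    have "\<bar>e a b - e' a b\<bar> < \<bar>e a b - e c d\<bar> / 2" "\<bar>e c d - e' c d\<bar> < \<bar>e a b - e c d\<bar> / 2"
      using that assms by blast+
    then show ?thesis
      by (auto simp: abs_if split: if_splits)
  qed
  then show "\<exists>\<delta>>0. \<forall>e'\<in>Met X. (\<forall>x\<in>topspace X. \<forall>y\<in>topspace X. \<bar>e x y - e' x y\<bar> < \<delta>) \<longrightarrow>
      e' \<in> {e \<in> Met X. e a b \<noteq> e c d}"
    using pos by blast
qed auto

text \<open>All distances between \<open>a\<close> and other points are raised by the same
  \<open>t\<close>. This adds a pseudometric, keeps the topology because \<open>a\<close> is
  isolated, and leaves \<open>e c d\<close> unchanged because neither \<open>c\<close> nor
  \<open>d\<close> is \<open>a\<close>.\<close>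

lemma perturb_isolated_distance:
  assumes e: "e \<in> Met X" and iso: "openin X {a}"
    and mem: "b \<in> topspace X - {a}" "c \<in> topspace X - {a}" "d \<in> topspace X - {a}"
    and "0 < (\<epsilon>::real)"
  shows "\<exists>e'\<in>Met X. e' a b \<noteq> e' c d \<and>
    (\<forall>x\<in>topspace X. \<forall>y\<in>topspace X. e x y \<le> e' x y \<and> e' x y \<le> e x y + \<epsilon>)"
proof -
  interpret Metric_space "topspace X" e
    using e by (rule Metric_space_of_Met)
  have a: "a \<in> topspace X"
    using openin_subset[OF iso] by simp
  obtain r where r: "r > 0" "\<forall>y\<in>topspace X. e a y < r \<longrightarrow> y = a"
    using iso unfolding openin_Met_iff[OF e] by auto
  \<comment> \<open>At most one value of \<open>t\<close> gives equality, so one of \<epsilon> and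
    \<epsilon>/2 works.\<close>
  define t where "t = (if e a b + \<epsilon> = e c d then \<epsilon> / 2 else \<epsilon>)"
  have t: "0 < t" "t \<le> \<epsilon>" "e a b + t \<noteq> e c d"
    using \<open>0 < \<epsilon>\<close> by (auto simp: t_def)
  let ?g = "\<lambda>x y. e x y + (if (x = a) = (y = a) then 0 else t)"
  let ?e = "\<lambda>x y. if x \<in> topspace X \<and> y \<in> topspace X then ?g x y else 0"
  have "?e \<in> Met X"
  proof (rule Met_dominatingI[OF e])
    fix x \<eta> assume x: "x \<in> topspace X" and \<eta>: "(0::real) < \<eta>"
    \<comment> \<open>Within this radius \<open>x\<close> and \<open>y\<close> are on the same side
      of the split into \<open>{a}\<close> and its complement, so \<open>t\<close> is not
      added.\<close>
    let ?\<delta> = "min \<eta> (if x = a then r else e x a)"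
    have "?\<delta> > 0"
      using \<eta> r x a by auto
    moreover have "?g x y < \<eta>" if "y \<in> topspace X" "e x y < ?\<delta>" for y
      using that r(2) by (cases "x = a"; cases "y = a") auto
    ultimately show "\<exists>\<delta>>0. \<forall>y\<in>topspace X. e x y < \<delta> \<longrightarrow> ?g x y < \<eta>"
      by blast
  next
    fix x y z assume "x \<in> topspace X" "y \<in> topspace X" "z \<in> topspace X"
    then show "?g x z \<le> ?g x y + ?g y z"
      using triangle[of x y z] t(1) by auto
  qed (use t(1) commute in auto)
  moreover have "?e a b \<noteq> ?e c d"
    using t(3) a mem by auto
  ultimately show ?thesis
    using t(1,2) by (intro bexI[of _ ?e]) auto
qed

text \<open>Replacing \<open>e\<close> by \<open>max e (sqrt (\<epsilon> * e))\<close> destroys all three-term arithmetic progressions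
  \<open>e x y = e y z = s\<close>, \<open>e x z = 2 * s\<close> with \<open>s < \<epsilon>\<close>. A bump function \<open>h\<close> supported near \<open>p\<close> then
  creates one starting at \<open>p\<close>, so that isometries cannot move \<open>p\<close> far.\<close>

lemma perturb_displacement:
  assumes e: "e \<in> Met X" and \<rho>: "\<rho> \<in> Met X" and p: "p \<in> topspace X"
    and lim: "\<not> openin X {p}" and "0 < \<epsilon>" and "0 < r"
  shows "\<exists>e'\<in>Met X. (\<forall>f\<in>Isom (topspace X) e'. \<rho> p (f p) < r) \<and>
    (\<forall>x\<in>topspace X. \<forall>y\<in>topspace X. e x y \<le> e' x y \<and> e' x y \<le> e x y + \<epsilon>)"
proof -
  interpret Metric_space "topspace X" e
    using e by (rule Metric_space_of_Met)
  obtain s0 where s0: "s0 > 0" "\<forall>x\<in>topspace X. e p x < s0 \<longrightarrow> \<rho> p x < r"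
    using Met_continuous_diagonal[OF e \<rho> p \<open>0 < r\<close>] by blast
  \<comment> \<open>The bound by \<epsilon> keeps the bump, of height \<open>2 * s\<close>, within
    the allowed perturbation; the bound by \<open>s0\<close> separates a far image of
    \<open>p\<close> from the support of the bump.\<close>
  define s where "s = min (\<epsilon> / 4) (s0 / 4)"
  have s: "0 < s" "2 * s < \<epsilon>" "3 * s < s0"
    using s0(1) \<open>0 < \<epsilon>\<close> by (auto simp: s_def)
  \<comment> \<open>Chosen with \<open>sqrt (\<epsilon> * w) = s\<close>: since
    \<open>w < s\<close>, this is exactly the \<open>e\<close>-distance that \<open>\<sigma>\<close>
    sends to \<open>s\<close>.\<close>
  define w where "w = s\<^sup>2 / \<epsilon>"
  have "s * s < s * \<epsilon>"
    using s by (intro mult_strict_left_mono) auto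
  then have w: "0 < w" "w < s" and \<epsilon>w: "\<epsilon> * w = s\<^sup>2"
    using s \<open>0 < \<epsilon>\<close> by (auto simp: w_def power2_eq_square pos_divide_less_eq)
  define \<sigma> where "\<sigma> t = max t (sqrt (\<epsilon> * t))" for t
  have \<sigma>_mono: "\<sigma> t \<le> \<sigma> u" if "t \<le> u" for t u
    using that \<open>0 < \<epsilon>\<close> unfolding \<sigma>_def by (intro max.mono) auto
  have \<sigma>_add: "\<sigma> (t + u) \<le> \<sigma> t + \<sigma> u" if "0 \<le> t" "0 \<le> u" for t u
    using sqrt_add_le_add_sqrt[of "\<epsilon> * t" "\<epsilon> * u"] that \<open>0 < \<epsilon>\<close>
    by (auto simp: \<sigma>_def distrib_left intro: add_mono order_trans[OF _ add_mono])
  have \<sigma>_le: "\<sigma> t \<le> t + \<epsilon>" if "0 \<le> t" for t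
  proof -
    have "\<epsilon> * t \<le> (t + \<epsilon>)\<^sup>2"
      using that \<open>0 < \<epsilon>\<close> by (simp add: power2_sum)
    then have "sqrt (\<epsilon> * t) \<le> t + \<epsilon>"
      using that \<open>0 < \<epsilon>\<close> by (intro real_le_lsqrt) auto
    then show ?thesis
      using \<open>0 < \<epsilon>\<close> by (simp add: \<sigma>_def)
  qed
  have \<sigma>_le_s: "\<sigma> t \<le> s \<longleftrightarrow> t \<le> w" for t
  proof -
    have "sqrt (\<epsilon> * t) \<le> s \<longleftrightarrow> sqrt (\<epsilon> * t) \<le> sqrt (\<epsilon> * w)"
      using s(1) by (simp add: \<epsilon>w)
    also have "\<dots> \<longleftrightarrow> t \<le> w"
      using \<open>0 < \<epsilon>\<close> by simp
    finally show ?thesis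
      using w by (auto simp: \<sigma>_def)
  qed
  \<comment> \<open>Two consecutive \<open>e\<close>-distances of at most \<open>w\<close> add up to
    at most \<open>2 * w\<close>, where \<open>\<sigma>\<close> is
    \<open>max (2 * w) (sqrt 2 * s)\<close>. Strictness here excludes progressions \<open>s\<close>,
    \<open>s\<close>, \<open>2 * s\<close> away from the bump.\<close>
  have \<sigma>_less_2s: "\<sigma> (2 * w) < 2 * s"
  proof -
    have "sqrt (\<epsilon> * (2 * w)) < 2 * s"
      using s(1) \<epsilon>w by (intro real_less_lsqrt) (auto simp: power2_eq_square mult.left_commute)
    then show ?thesis
      using w by (simp add: \<sigma>_def)
  qed
  have near: "\<exists>x\<in>topspace X. x \<noteq> p \<and> e p x < \<tau>" if "\<tau> > 0" for \<tau>
    using lim p that unfolding openin_Met_iff[OF e] by auto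
  \<comment> \<open>Both points will lie within \<open>w / 2\<close> of \<open>p\<close>, so
    \<open>\<sigma>\<close> is at most \<open>s\<close> on all distances among \<open>p\<close>,
    \<open>y\<close>, \<open>z\<close>. Taking \<open>z\<close> strictly nearer than
    \<open>y\<close> makes them distinct.\<close>
  obtain y where y: "y \<in> topspace X" "y \<noteq> p" "e p y < w / 2"
    using near[of "w / 2"] w by auto
  obtain z where z: "z \<in> topspace X" "z \<noteq> p" "e p z < min (w / 2) (e p y)"
    using near[of "min (w / 2) (e p y)"] w y p by auto
  then have "z \<noteq> y"
    by auto
  define \<kappa> where "\<kappa> = min (e y z) (min (e p y) (e p z))"
  have \<kappa>: "0 < \<kappa>" "\<kappa> \<le> e y z" "\<kappa> \<le> e p y" "\<kappa> \<le> e p z"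
    using p y z \<open>z \<noteq> y\<close> by (auto simp: \<kappa>_def)
  \<comment> \<open>With this slope the cones of height \<open>s\<close> at \<open>y\<close> and
    \<open>2 * s\<close> at \<open>z\<close> vanish from distance \<open>\<kappa>\<close> on, so
    each is 0 at the other two of the three points.\<close>
  define k where "k = 2 * s / \<kappa>"
  have "0 < k"
    using s(1) \<kappa>(1) by (simp add: k_def)
  have k: "2 * s \<le> k * t" if "\<kappa> \<le> t" for t
    using mult_left_mono[OF that, of k] \<open>0 < k\<close> \<kappa>(1) by (simp add: k_def)
  define h where "h x = max 0 (max (s - k * e x y) (2 * s - k * e x z))" for x
  have h_bounds: "0 \<le> h x" "h x \<le> 2 * s" for x
    using s(1) mult_nonneg_nonneg[OF less_imp_le[OF \<open>0 < k\<close>] nonneg[of x y]]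
      mult_nonneg_nonneg[OF less_imp_le[OF \<open>0 < k\<close>] nonneg[of x z]]
    by (simp_all add: h_def)
  have hp: "h p = 0" and hy: "h y = s" and hz: "h z = 2 * s"
    using k[OF \<kappa>(2)] k[OF \<kappa>(3)] k[OF \<kappa>(4)] s(1) p y(1) z(1) by (auto simp: h_def commute[of z y])
  have h_lipschitz: "\<bar>h x - h u\<bar> \<le> k * e x u" if "x \<in> topspace X" "u \<in> topspace X" for x u
  proof -
    have "\<bar>k * e x v - k * e u v\<bar> \<le> k * e x u" if "v \<in> topspace X" for v
    proof -
      have "\<bar>e x v - e u v\<bar> \<le> e x u"
        using triangle[of x u v] triangle[of u x v] that \<open>x \<in> _\<close> \<open>u \<in> _\<close> by (simp add: commute)
      then have "k * \<bar>e x v - e u v\<bar> \<le> k * e x u"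
        using \<open>0 < k\<close> by simp
      then show ?thesis
        using \<open>0 < k\<close> by (simp add: abs_mult right_diff_distrib[symmetric])
    qed
    from this[OF y(1)] this[OF z(1)] show ?thesis
      unfolding h_def by linarith
  qed
  \<comment> \<open>The cones have radius at most \<open>\<kappa>\<close>, which is at most
    \<open>e p y\<close> and \<open>e p z\<close>, both below \<open>w / 2\<close>.\<close>
  have supp: "e p x < w" if "x \<in> topspace X" "h x \<noteq> 0" for x
  proof -
    have "e x y < \<kappa> \<or> e x z < \<kappa>"
      using k[of "e x y"] k[of "e x z"] s(1) that(2) by (force simp: h_def)
    then show ?thesis
      using triangle[of p y x] triangle[of p z x] p y z \<kappa> that(1) by (auto simp: commute)
  qed
  \<comment> \<open>Maximum of the snowflaked metric and the pseudometric of \<open>h\<close>: the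
    former already dominates \<open>e\<close>, the latter contributes the values \<open>s\<close>,
    \<open>s\<close>, \<open>2 * s\<close> on \<open>p\<close>, \<open>y\<close>,
    \<open>z\<close>.\<close>
  let ?g = "\<lambda>x u. max (\<sigma> (e x u)) \<bar>h x - h u\<bar>"
  let ?e = "\<lambda>x u. if x \<in> topspace X \<and> u \<in> topspace X then ?g x u else 0"
  have e_le: "e x u \<le> ?g x u" for x u
    by (simp add: \<sigma>_def)
  have "?e \<in> Met X"
  proof (rule Met_dominatingI[OF e e_le])
    fix x u v assume xuv: "x \<in> topspace X" "u \<in> topspace X" "v \<in> topspace X"
    have "\<sigma> (e x v) \<le> \<sigma> (e x u) + \<sigma> (e u v)"
      using \<sigma>_mono[OF triangle[OF xuv]] \<sigma>_add[of "e x u" "e u v"] by simp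
    then show "?g x v \<le> ?g x u + ?g u v"
      by linarith
  next
    fix x \<eta> assume x: "x \<in> topspace X" and \<eta>: "(0::real) < \<eta>"
    \<comment> \<open>The three bounds control, in order, \<open>e x u\<close>,
      \<open>sqrt (\<epsilon> * e x u)\<close> and the variation of the Lipschitz function
      \<open>h\<close>.\<close>
    define \<delta> where "\<delta> = min \<eta> (min (\<eta>\<^sup>2 / \<epsilon>) (\<eta> / k))"
    have "\<delta> > 0"
      using \<eta> \<open>0 < \<epsilon>\<close> \<open>0 < k\<close> by (simp add: \<delta>_def)
    moreover have "?g x u < \<eta>" if u: "u \<in> topspace X" and less: "e x u < \<delta>" for u
    proof -
      have "\<epsilon> * e x u < \<eta>\<^sup>2" "k * e x u < \<eta>"
        using less \<open>0 < \<epsilon>\<close> \<open>0 < k\<close> by (simp_all add: \<delta>_def pos_less_divide_eq mult.commute)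
      then have "sqrt (\<epsilon> * e x u) < \<eta>" "\<bar>h x - h u\<bar> < \<eta>"
        using h_lipschitz[OF x u] \<eta> by (auto intro!: real_less_lsqrt)
      then show ?thesis
        using less by (simp add: \<sigma>_def \<delta>_def)
    qed
    ultimately show "\<exists>\<delta>>0. \<forall>u\<in>topspace X. e x u < \<delta> \<longrightarrow> ?g x u < \<eta>"
      by blast
  qed (auto simp: \<sigma>_def commute abs_minus_commute)
  moreover have "\<rho> p (f p) < r" if f: "f \<in> Isom (topspace X) ?e" for f
  proof -
    have fM: "f x \<in> topspace X" if "x \<in> topspace X" for x
      using f that by (auto simp: Isom_def bij_betw_def)
    have fg: "?g (f x) (f u) = ?g x u" if "x \<in> topspace X" "u \<in> topspace X" for x u
    proof -
      have "?e (f x) (f u) = ?e x u"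
        using f that unfolding Isom_def by blast
      then show ?thesis
        using that fM by simp
    qed
    have small: "\<sigma> (e x u) \<le> s" if "e x u \<le> w" for x u
      using that \<sigma>_le_s by simp
    have "e y z \<le> w"
      using triangle[of y p z] p y z by (simp add: commute)
    then have "?g p y = s" "?g y z = s" "?g p z = 2 * s"
      using small[of p y] small[of y z] small[of p z] y(3) z(3) w s(1) by (auto simp: hp hy hz)
    then have g: "?g (f p) (f y) = s" "?g (f y) (f z) = s" "?g (f p) (f z) = 2 * s"
      using fg p y(1) z(1) by simp_all
    then have ew: "e (f p) (f y) \<le> w" "e (f y) (f z) \<le> w"
      using \<sigma>_le_s by (metis max.cobounded1)+
    \<comment> \<open>If \<open>p\<close> moved far, then \<open>f p\<close> and \<open>f z\<close>,
      at most \<open>2 * s\<close> apart, would both lie outside the support of \<open>h\<close>; so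
      \<open>\<sigma>\<close> alone would give their distance \<open>2 * s\<close>, although passing
      through \<open>f y\<close> bounds \<open>e\<close> by \<open>2 * w\<close>.\<close>
    have "e p (f p) < s0"
    proof (rule ccontr)
      assume "\<not> e p (f p) < s0"
      then have far: "3 * s < e p (f p)"
        using s by simp
      have "w < e p (f p)" "w < e p (f z)"
        using triangle[of p "f z" "f p"] e_le[of "f p" "f z"] g(3) far w s(1) p z(1) fM
        by (auto simp: commute)
      then have "h (f p) = 0" "h (f z) = 0"
        using supp fM p z(1) by force+
      then have "\<sigma> (e (f p) (f z)) = 2 * s"
        using g(3) s(1) by (auto simp: max_def split: if_splits)
      moreover have "e (f p) (f z) \<le> 2 * w"
        using triangle[of "f p" "f y" "f z"] ew p y(1) z(1) fM by simp
      then have "\<sigma> (e (f p) (f z)) < 2 * s"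
        using \<sigma>_mono \<sigma>_less_2s le_less_trans by blast
      ultimately show False
        by simp
    qed
    then show ?thesis
      using s0(2) p fM by blast
  qed
  moreover have "?e x u \<le> e x u + \<epsilon>" if "x \<in> topspace X" "u \<in> topspace X" for x u
  proof -
    have "\<bar>h x - h u\<bar> \<le> e x u + \<epsilon>"
      using h_bounds[of x] h_bounds[of u] s(2) nonneg[of x u] by linarith
    then show ?thesis
      using \<sigma>_le[of "e x u"] that by simp
  qed
  ultimately show ?thesis
    using e_le by (intro bexI[of _ ?e]) auto
qed

section \<open>Countable dense sets and reduction of rigidity to dense points\<close>

lemma compact_imp_countable_dense_Met:
  assumes "compact_space X" and \<rho>: "\<rho> \<in> Met X"
  obtains D where "countable D" "D \<subseteq> topspace X" "X closure_of D = topspace X"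
proof -
  interpret Metric_space "topspace X" \<rho>
    using \<rho> by (rule Metric_space_of_Met)
  have X: "mtopology = X"
    using \<rho> by (simp add: Met_def)
  have "mtotally_bounded (topspace X)"
    using assms(1) compactin_imp_mtotally_bounded[of "topspace X"] by (simp add: X compact_space_def)
  then have "\<exists>K. finite K \<and> K \<subseteq> topspace X \<and> topspace X \<subseteq> (\<Union>x\<in>K. mball x (inverse (real (Suc n))))" for n
    unfolding mtotally_bounded_def by simp
  then obtain K where K: "\<And>n. finite (K n)" "\<And>n. K n \<subseteq> topspace X"
      "\<And>n. topspace X \<subseteq> (\<Union>x\<in>K n. mball x (inverse (real (Suc n))))"
    by metis
  show ?thesis
  proof
    show "countable (\<Union>n. K n)"
      using K(1) by (auto intro: countable_finite)
    show "(\<Union>n. K n) \<subseteq> topspace X"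
      using K(2) by blast
    have "\<exists>y\<in>\<Union>n. K n. y \<in> mball x r" if x: "x \<in> topspace X" and r: "r > 0" for x r
    proof -
      obtain n where n: "inverse (real (Suc n)) < r"
        using reals_Archimedean[OF r] by blast
      obtain y where y: "y \<in> K n" "x \<in> mball y (inverse (real (Suc n)))"
        using K(3)[of n] x by blast
      then have "y \<in> mball x r"
        using n by (auto simp: commute)
      then show ?thesis
        using y(1) by blast
    qed
    then have "mtopology closure_of (\<Union>n. K n) = topspace X"
      unfolding metric_closure_of by blast
    then show "X closure_of (\<Union>n. K n) = topspace X"
      unfolding X .
  qed
qed

lemma Met_eqI:
  assumes e: "e \<in> Met X" and "x \<in> topspace X" "y \<in> topspace X"
    and less: "\<And>n. e x y < inverse (real (Suc n))"
  shows "y = x"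
proof -
  interpret Metric_space "topspace X" e
    using e by (rule Metric_space_of_Met)
  have "e x y \<le> 0"
    using less by (intro LIMSEQ_le_const[OF LIMSEQ_inverse_real_of_nat]) (auto intro: less_imp_le)
  then show ?thesis
    using zero[OF assms(2,3)] nonneg[of x y] by (metis order_antisym)
qed

lemma restrict_id_Isom: "(\<lambda>x\<in>M. x) \<in> Isom M e"
  by (auto simp: Isom_def bij_betw_def inj_on_def)

text \<open>For \<open>y \<in> D\<close> near \<open>x\<close>, \<open>f\<close> fixes
  \<open>y\<close>, so \<open>e x (f x)\<close> is at most
  \<open>e x y + e y (f x) = 2 * e x y\<close>. Extensionality settles equality off the
  carrier.\<close>

lemma Isom_eq_id_on_dense:
  assumes e: "e \<in> Met X" and D: "X closure_of D = topspace X" "D \<subseteq> topspace X"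
    and f: "f \<in> Isom (topspace X) e" and fixD: "\<And>x. x \<in> D \<Longrightarrow> f x = x"
  shows "f = (\<lambda>x\<in>topspace X. x)"
proof -
  interpret Metric_space "topspace X" e
    using e by (rule Metric_space_of_Met)
  have X: "mtopology = X"
    using e by (simp add: Met_def)
  have "f x = x" if x: "x \<in> topspace X" for x
  proof -
    have fx: "f x \<in> topspace X"
      using f x by (auto simp: Isom_def bij_betw_def)
    show ?thesis
    proof (rule Met_eqI[OF e x fx])
      fix n
      define \<epsilon> where "\<epsilon> = inverse (real (Suc n))"
      have \<epsilon>: "0 < \<epsilon>"
        by (simp add: \<epsilon>_def)
      have "x \<in> mtopology closure_of D"
        using D(1) x X by simp
      moreover have "0 < \<epsilon> / 2"
        using \<epsilon> by simp
      ultimately obtain y where y: "y \<in> D" "y \<in> mball x (\<epsilon> / 2)"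
        unfolding metric_closure_of by blast
      then have "y \<in> topspace X"
        using D(2) by blast
      then have "e (f x) (f y) = e x y"
        using f x by (simp add: Isom_def)
      then have "e x (f x) < \<epsilon>"
        using triangle[of x y "f x"] x y fx fixD[OF y(1)] by (simp add: commute)
      then show "e x (f x) < inverse (real (Suc n))"
        unfolding \<epsilon>_def .
    qed
  qed
  moreover have "f \<in> extensional (topspace X)"
    using f by (simp add: Isom_def)
  ultimately show ?thesis
    by (auto simp: extensional_def restrict_def fun_eq_iff)
qed

lemma rigid_metricsI_dense:
  assumes e: "e \<in> Met X" and D: "X closure_of D = topspace X" "D \<subseteq> topspace X"
    and fixD: "\<And>f x. \<lbrakk>f \<in> Isom (topspace X) e; x \<in> D\<rbrakk> \<Longrightarrow> f x = x"
  shows "e \<in> rigid_metrics X"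
proof -
  have "f = (\<lambda>x\<in>topspace X. x)" if "f \<in> Isom (topspace X) e" for f
    using Isom_eq_id_on_dense[OF e D that fixD[OF that]] .
  then have "Isom (topspace X) e = {\<lambda>x\<in>topspace X. x}"
    using restrict_id_Isom by blast
  then show ?thesis
    using e by (simp add: rigid_metrics_def)
qed

text \<open>Displacement is measured by one reference metric \<open>\<rho>\<close>, so
  \<open>e\<close> enters each condition only through its isometry group; displacement below every
  \<open>1 / (n + 1)\<close> at the points of \<open>D\<close> means that \<open>D\<close> is fixed
  pointwise.\<close>

lemma rigid_metrics_eq_Inter_displacement:
  assumes \<rho>: "\<rho> \<in> Met X" and D: "X closure_of D = topspace X" "D \<subseteq> topspace X"
  shows "rigid_metrics X =
    Met X \<inter> (\<Inter>x\<in>D. \<Inter>n. {e \<in> Met X. \<forall>f\<in>Isom (topspace X) e. \<rho> x (f x) < inverse (real (Suc n))})"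
    (is "_ = ?R")
proof
  interpret Metric_space "topspace X" \<rho>
    using \<rho> by (rule Metric_space_of_Met)
  show "rigid_metrics X \<subseteq> ?R"
    using D(2) by (auto simp: rigid_metrics_def)
  show "?R \<subseteq> rigid_metrics X"
  proof
    fix e assume e: "e \<in> ?R"
    show "e \<in> rigid_metrics X"
    proof (rule rigid_metricsI_dense[OF _ D])
      fix f x assume f: "f \<in> Isom (topspace X) e" and x: "x \<in> D"
      show "f x = x"
      proof (rule Met_eqI[OF \<rho>])
        show "x \<in> topspace X" "f x \<in> topspace X"
          using f x D(2) by (auto simp: Isom_def bij_betw_def)
        show "\<rho> x (f x) < inverse (real (Suc n))" for n
          using e f x by blast
      qed
    qed (use e in blast)
  qed
qed

text \<open>An isometry carries the ball that isolates \<open>p\<close> onto the ball of the same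
  radius around \<open>f p\<close>; surjectivity excludes further points there.\<close>

lemma Isom_isolated:
  assumes e: "e \<in> Met X" and f: "f \<in> Isom (topspace X) e" and p: "openin X {p}"
  shows "openin X {f p}"
proof -
  have bij: "bij_betw f (topspace X) (topspace X)"
    and iso: "\<And>x y. \<lbrakk>x \<in> topspace X; y \<in> topspace X\<rbrakk> \<Longrightarrow> e (f x) (f y) = e x y"
    using f by (auto simp: Isom_def)
  have pM: "p \<in> topspace X"
    using openin_subset[OF p] by simp
  obtain r where r: "r > 0" "\<forall>y\<in>topspace X. e p y < r \<longrightarrow> y = p"
    using p unfolding openin_Met_iff[OF e] by auto
  have "y = f p" if "y \<in> topspace X" "e (f p) y < r" for y
  proof -
    have "y \<in> f ` topspace X"
      using bij_betw_imp_surj_on[OF bij] that(1) by simp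
    then obtain x where "x \<in> topspace X" "y = f x"
      by blast
    then show ?thesis
      using iso[OF pM] r(2) that(2) by auto
  qed
  then show ?thesis
    using r(1) pM bij unfolding openin_Met_iff[OF e] by (auto simp: bij_betw_def)
qed

lemma isolated_mem_dense:
  assumes "X closure_of D = topspace X" and p: "openin X {p}"
  shows "p \<in> D"
proof -
  have "p \<in> X closure_of D"
    using openin_subset[OF p] assms(1) by simp
  then show ?thesis
    using p unfolding in_closure_of by blast
qed

text \<open>If \<open>f p = q \<noteq> p\<close> for an isolated \<open>p\<close>, compare
  the distances from \<open>p\<close> and \<open>q\<close> to a third point \<open>c\<close> and its image.\<close>

lemma Isom_fixes_dense:
  assumes e: "e \<in> Met X" and D: "X closure_of D = topspace X" "D \<subseteq> topspace X"
    and fixlim: "\<And>f x. \<lbrakk>f \<in> Isom (topspace X) e; x \<in> D; \<not> openin X {x}\<rbrakk> \<Longrightarrow> f x = x"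
    and neq: "\<And>a b c d. \<lbrakk>openin X {a}; b \<in> D - {a}; c \<in> D - {a}; d \<in> D - {a}\<rbrakk> \<Longrightarrow> e a b \<noteq> e c d"
    and card: "infinite (topspace X) \<or> card (topspace X) > 2"
    and f: "f \<in> Isom (topspace X) e" and p: "p \<in> D"
  shows "f p = p"
proof (rule ccontr)
  assume q: "f p \<noteq> p"
  then have isop: "openin X {p}"
    using fixlim f p by blast
  have injf: "inj_on f (topspace X)"
    and iso: "\<And>x y. \<lbrakk>x \<in> topspace X; y \<in> topspace X\<rbrakk> \<Longrightarrow> e (f x) (f y) = e x y"
    using f by (auto simp: Isom_def bij_betw_def)
  have isoq: "openin X {f p}"
    using Isom_isolated[OF e f isop] .
  interpret Metric_space "topspace X" e
    using e by (rule Metric_space_of_Met)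
  have "f p \<in> topspace X"
    using openin_subset[OF isoq] by simp
  then have "closedin mtopology {p, f p}"
    using p D(2) Hausdorff_space_mtopology by (intro closedin_Hausdorff_finite) auto
  then have "openin X (topspace X - {p, f p})"
    using e by (auto simp: Met_def closedin_def)
  \<comment> \<open>The cardinality hypothesis enters here: on a two-point space the swap is always
    an isometry.\<close>
  moreover have "topspace X - {p, f p} \<noteq> {}"
  proof
    assume "topspace X - {p, f p} = {}"
    then have sub: "topspace X \<subseteq> {p, f p}"
      by blast
    then have "card (topspace X) \<le> card {p, f p}"
      by (intro card_mono) auto
    then show False
      using card sub q by (auto dest: finite_subset)
  qed
  ultimately have "D \<inter> (topspace X - {p, f p}) \<noteq> {}"
    using D(1) unfolding dense_intersects_open by blast
  then obtain c where c: "c \<in> D" "c \<noteq> p" "c \<noteq> f p"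
    by blast
  have qD: "f p \<in> D"
    using isolated_mem_dense[OF D(1) isoq] .
  \<comment> \<open>If \<open>c\<close> is isolated, so is \<open>f c\<close>, and the dense set
    contains it; otherwise \<open>f c = c\<close>.\<close>
  have fcD: "f c \<in> D"
    using isolated_mem_dense[OF D(1) Isom_isolated[OF e f]] fixlim[OF f c(1)] c(1) by metis
  have ecp: "e p c = e (f p) (f c)"
    using iso[of p c] p c(1) D(2) by (metis subsetD)
  show False
  \<comment> \<open>If \<open>f c\<close> is not \<open>p\<close>, the identity equates a distance
    from \<open>p\<close> with one avoiding \<open>p\<close>. If \<open>f c = p\<close>, then
    \<open>c\<close> is isolated and \<open>e c p = e (f p) p\<close> equates a distance from
    \<open>c\<close> with one avoiding \<open>c\<close>.\<close>
  proof (cases "f c = p")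
    case False
    then show False
      using neq[OF isop, of c "f p" "f c"] ecp c qD fcD q by blast
  next
    case True
    then have "openin X {c}"
      using fixlim[OF f c(1)] c(2) by metis
    then show False
      using neq[of c p "f p" p] ecp True c p qD by (auto simp: commute)
  qed
qed

section \<open>Existence of a compatible metric and the final Baire argument\<close>

lemma metrizable_space_imp_Met:
  assumes "metrizable_space X"
  obtains \<rho> where "\<rho> \<in> Met X"
proof -
  obtain M d where "Metric_space M d" "X = Metric_space.mtopology M d"
    using assms unfolding metrizable_space_def by blast
  then have Md: "Metric_space (topspace X) d" "Metric_space.mtopology (topspace X) d = X"
    using Metric_space.topspace_mtopology by metis+
  \<comment> \<open>Values off the carrier are cut to 0 to meet the normalisation in
    \<open>Met\<close>.\<close>
  define \<rho> where "\<rho> x y = (if x \<in> topspace X \<and> y \<in> topspace X then d x y else 0)" for x y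
  have \<rho>: "Metric_space (topspace X) \<rho>"
    using Md(1) by (simp add: Metric_space_def \<rho>_def)
  have "Metric_space.mball (topspace X) \<rho> = Metric_space.mball (topspace X) d"
    unfolding Metric_space.mball_def[OF Md(1)] Metric_space.mball_def[OF \<rho>]
    by (auto simp: \<rho>_def fun_eq_iff)
  then have "Metric_space.mtopology (topspace X) \<rho> = Metric_space.mtopology (topspace X) d"
    unfolding topology_eq Metric_space.openin_mtopology[OF Md(1)]
      Metric_space.openin_mtopology[OF \<rho>] by simp
  with \<rho> Md(2) have "\<rho> \<in> Met X"
    by (simp add: Met_def \<rho>_def)
  then show thesis
    by (rule that)
qed

theorem theorem5p3:
  fixes X :: "'a topology"
  assumes "compact_space X" and "metrizable_space X"
    and "infinite (topspace X) \<or> card (topspace X) > 2"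
  shows "gdelta_in (Met_topology X) (rigid_metrics X)
       \<and> Met_topology X closure_of rigid_metrics X = Met X"
proof -
  obtain \<rho> where \<rho>: "\<rho> \<in> Met X"
    using metrizable_space_imp_Met[OF assms(2)] .
  obtain D where D: "countable D" "D \<subseteq> topspace X" "X closure_of D = topspace X"
    using compact_imp_countable_dense_Met[OF assms(1) \<rho>] .
  define W where "W x n = {e \<in> Met X. \<forall>f\<in>Isom (topspace X) e. \<rho> x (f x) < inverse (real (Suc n))}" for x n
  have openW: "openin (Met_topology X) (W x n)" if "x \<in> D" for x n
    unfolding W_def using that D(2) by (intro openin_displacement[OF assms(1) \<rho>]) auto
  have rigid: "rigid_metrics X = Met X \<inter> (\<Inter>x\<in>D. \<Inter>n. W x n)"
    unfolding W_def by (rule rigid_metrics_eq_Inter_displacement[OF \<rho> D(3,2)])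
  have "gdelta_in (Met_topology X) (rigid_metrics X)"
  proof -
    \<comment> \<open>Listing \<open>Met X\<close> as a member makes the family nonempty without a
      case distinction on \<open>D\<close>.\<close>
    let ?T = "insert (Met X) ((\<lambda>(x, n). W x n) ` (D \<times> UNIV))"
    have "rigid_metrics X = \<Inter>?T"
      unfolding rigid by auto
    moreover have "gdelta_in (Met_topology X) (\<Inter>?T)"
    proof (rule gdelta_in_Inter)
      show "countable ?T"
        using D(1) by simp
      show "gdelta_in (Met_topology X) S" if "S \<in> ?T" for S
        using that openW gdelta_in_topspace[of "Met_topology X"] by (auto intro: open_imp_gdelta_in)
    qed simp
    ultimately show ?thesis
      by simp
  qed
  moreover have "Met_topology X closure_of rigid_metrics X = Met X"
  proof -
    \<comment> \<open>The displacement conditions are kept only at limit points, where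
      \<open>perturb_displacement\<close> can realise them; at isolated points the inequalities
      indexed by \<open>Q\<close> take their place. Restricting everything to \<open>D\<close> keeps
      the family countable.\<close>
    define L where "L = {x \<in> D. \<not> openin X {x}}"
    define Q where "Q = {(a, b, c, d). openin X {a} \<and> a \<in> D \<and> b \<in> D - {a} \<and> c \<in> D - {a} \<and> d \<in> D - {a}}"
    define V where "V = (\<lambda>(a, b, c, d). {e \<in> Met X. e a b \<noteq> e c d})"
    let ?U = "(\<lambda>(x, n). W x n) ` (L \<times> UNIV) \<union> V ` Q"
    have "Q \<subseteq> D \<times> D \<times> D \<times> D"
      by (auto simp: Q_def)
    then have "countable ?U"
      using D(1) by (auto simp: L_def intro!: countable_image countable_SIGMA elim!: countable_subset)
    have openU: "openin (Met_topology X) U" if "U \<in> ?U" for U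
      using that openW D(2) by (auto simp: L_def Q_def V_def intro!: openin_Met_distances_neq)
    have approx: "\<exists>e'\<in>U. \<forall>x\<in>topspace X. \<forall>y\<in>topspace X. e x y \<le> e' x y \<and> e' x y \<le> e x y + \<epsilon>"
      if U: "U \<in> ?U" and e: "e \<in> Met X" and \<epsilon>: "0 < \<epsilon>" for U e \<epsilon>
      using U
    proof
      assume "U \<in> (\<lambda>(x, n). W x n) ` (L \<times> UNIV)"
      then obtain x n where x: "x \<in> topspace X" "\<not> openin X {x}" and UW: "U = W x n"
        using D(2) by (auto simp: L_def)
      show ?thesis
        using perturb_displacement[OF e \<rho> x \<epsilon>, of "inverse (real (Suc n))"] unfolding UW W_def by auto
    next
      assume "U \<in> V ` Q"
      then obtain a b c d where q: "(a, b, c, d) \<in> Q" and UV: "U = V (a, b, c, d)"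
        by auto
      then have "openin X {a}" "b \<in> topspace X - {a}" "c \<in> topspace X - {a}" "d \<in> topspace X - {a}"
        using D(2) by (auto simp: Q_def)
      from perturb_isolated_distance[OF e this \<epsilon>] show ?thesis
        unfolding UV V_def by auto
    qed
    have sub: "Met X \<inter> \<Inter>?U \<subseteq> rigid_metrics X"
    proof
      fix e assume e: "e \<in> Met X \<inter> \<Inter>?U"
      have lim: "f x = x" if f: "f \<in> Isom (topspace X) e" and x: "x \<in> D" "\<not> openin X {x}" for f x
      proof (rule Met_eqI[OF \<rho>])
        show "x \<in> topspace X" "f x \<in> topspace X"
          using f x(1) D(2) by (auto simp: Isom_def bij_betw_def)
        fix n
        have "W x n \<in> ?U"
          using x by (auto simp: L_def)
        with e have "e \<in> W x n"
          by (rule InterD[OF IntD2])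
        then show "\<rho> x (f x) < inverse (real (Suc n))"
          using f unfolding W_def by blast
      qed
      have neq: "e a b \<noteq> e c d"
        if "openin X {a}" "b \<in> D - {a}" "c \<in> D - {a}" "d \<in> D - {a}" for a b c d
      proof -
        have "(a, b, c, d) \<in> Q"
          using that isolated_mem_dense[OF D(3)] by (simp add: Q_def)
        then have "V (a, b, c, d) \<in> ?U"
          by blast
        with e have "e \<in> V (a, b, c, d)"
          by (rule InterD[OF IntD2])
        then show ?thesis
          by (simp add: V_def)
      qed
      have eM: "e \<in> Met X"
        using e by (rule IntD1)
      show "e \<in> rigid_metrics X"
      proof (rule rigid_metricsI_dense[OF eM D(3,2)])
        show "f p = p" if "f \<in> Isom (topspace X) e" "p \<in> D" for f p
          by (rule Isom_fixes_dense[OF eM D(3,2) _ _ assms(3) that])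
            ((rule lim; assumption), (rule neq; assumption))
      qed
    qed
    have "\<exists>e\<in>rigid_metrics X. bdd_sup_dist X d e < \<epsilon>" if "d \<in> Met X" "0 < \<epsilon>" for d \<epsilon>
    proof -
      have "\<exists>e\<in>Met X \<inter> \<Inter>?U. bdd_sup_dist X d e < \<epsilon>"
        by (rule dense_Inter_Met[OF \<open>countable ?U\<close> openU approx that])
      then show ?thesis
        by (rule bexE) (rule bexI, assumption, rule subsetD[OF sub])
    qed
    then show ?thesis
      unfolding Met_topology_def Metric_space.metric_closure_of[OF Metric_space_Met]
        Metric_space.in_mball[OF Metric_space_Met]
      by (fastforce simp: rigid_metrics_def)
  qed
  ultimately show ?thesis ..
qed

end
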